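(* Let $V_h$ be the unitarizable Verma module over $\mathfrak{sl}(2,\mathbb{C})$ of extremal weight $h$, realized in $\mathbb{C}[z]$, with operators $L_k$ and $J_k$ ($k\in\mathbb{Z}$). (1) For $h=1$ and for $h=\tfrac12$, the $\mathcal{HS}$-projective representation $T(e_k)=L_k$ ($k\in\mathbb{Z}$) of the Witt algebra $\mathfrak{w}^{\mathbb{C}}$ in $V_h$ is $\mathcal{FR}$-projective, where $\mathcal{FR}$ is the algebra of finite-rank operators. (2) For $h=\tfrac12$, the $\mathcal{HS}$-projective representation $T(e_k)=L_k$, $T(a_k)=J_k$ ($k\in\mathbb{Z}$), $T(c)=0$ of the semidirect sum of the Witt algebra and the infinite-dimensional Heisenberg algebra in $V_h$ is also $\mathcal{FR}$-projective.
   Context: **Verma modules.** $\mathfrak{sl}(2,\mathbb{C})$ has basis $l_{-1},l_0,l_1$ with $[l_i,l_j]=(i-j)l_{i+j}$. The Verma module $V_h$ of extremal weight $h$ is $\mathbb{C}[z]$ with $$l_{-1}=z,\quad l_0=z\partial_z+h,\quad l_1=z\partial_z^2+2h\partial_z.$$ It is unitarizable for $h>0$, i.e. it carries a pre-Hilbert structure with $l_i^*=l_{-i}$. **Operators.** Put $\xi=z\partial_z$; a rational function $f(\xi)$ acts by $f(\xi)z^n=f(n)z^n$, and $z^kf(\xi)$ means first apply $f(\xi)$, then multiply by $z^k$. The $q_R$-conformal symmetries are $$L_k=(\xi+(k+1)h)\partial_z^k\ (k\ge 0),\qquad L_{-k}=z^k\,\frac{\xi+(k+1)h}{(\xi+2h)(\xi+2h+1)\cdots(\xi+2h+k-1)}\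 (k\ge1).$$ Further, $D=\partial_z$, $F=z\frac{1}{\xi+2h}$, and $J_k=D^k$, $J_{-k}=F^k$ for $k\ge0$. **Lie algebras.** The Witt algebra $\mathfrak{w}^{\mathbb{C}}$ has basis $e_k$ ($k\in\mathbb{Z}$), with $[e_j,e_k]=(j-k)e_{j+k}$. The Heisenberg algebra is the one-dimensional central extension of the abelian Lie algebra $\mathbb{C}[z,z^{-1}]$, with basis $a_k$ ($k\in\mathbb{Z}$, corresponding to $z^k$) and central $c$, with $[a_n,a_m]=n\,\delta_{n+m,0}\,c$. In the semidirect sum, $[e_n,a_k]=-k\,a_{n+k}$ and $[e_n,c]=0$. **$\mathfrak{A}$-projective representations.** For an algebra $\mathfrak{A}$ of operators and a Lie algebra $\mathfrak{g}$, a linear map $T$ from $\mathfrak{g}$ to linear operators (here on $\mathbb{C}[z]$) is an $\mathfrak{A}$-projective representation if $[T(X),T(Y)]-T([X,Y])\in\mathfrak{A}$ for all $X,Y\in\mathfrak{g}$. For $\mathfrak{A}=\mathcal{HS}$ this means that the difference extends to a Hilbert–Schmidt operator on the Hilbert space completion of $V_h$; for $\mathfrak{A}=\mathcal{FR}$, that it has finite rank (as a bounded operator on the completion). *)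

theory Defs
  imports
    "HOL-Analysis.Analysis"
    "HOL-Library.Poly_Mapping"
    "HOL-Computational_Algebra.Polynomial_FPS"
begin

section \<open>Vector spaces\<close>

text \<open>
  A complex vector space with a prescribed basis indexed by a type \<open>'i\<close> is rendered as the
  space of finitely supported functions \<open>'i \<Rightarrow>\<^sub>0 complex\<close>; the basis vector with index \<open>i\<close>
  is \<open>Poly_Mapping.single i 1\<close>.
\<close>

definition pm_scale :: "complex \<Rightarrow> ('i \<Rightarrow>\<^sub>0 complex) \<Rightarrow> ('i \<Rightarrow>\<^sub>0 complex)" where
  "pm_scale c X = Poly_Mapping.map ((*) c) X"

lemma lookup_pm_scale [simp]: "Poly_Mapping.lookup (pm_scale c X) i = c * Poly_Mapping.lookup X i"
  unfolding pm_scale_def by (cases "Poly_Mapping.lookup X i = 0") (simp_all add: Poly_Mapping.map.rep_eq)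

definition fps_scale :: "complex \<Rightarrow> complex fps \<Rightarrow> complex fps" where
  "fps_scale c f = fps_const c * f"

lemma fps_scale_nth [simp]: "fps_nth (fps_scale c f) n = c * fps_nth f n"
  by (simp add: fps_scale_def)

interpretation pm_vs: vector_space pm_scale
  by unfold_locales (auto intro!: poly_mapping_eqI simp: lookup_add algebra_simps)

interpretation poly_vs: vector_space "smult :: complex \<Rightarrow> complex poly \<Rightarrow> complex poly"
  by unfold_locales (auto simp: smult_add_right smult_add_left)

interpretation fps_vs: vector_space fps_scale
  by unfold_locales (auto simp: fps_eq_iff algebra_simps)

definition lin_ext :: "(complex \<Rightarrow> 'v \<Rightarrow> 'v) \<Rightarrow> ('i \<Rightarrow> 'v) \<Rightarrow> ('i \<Rightarrow>\<^sub>0 complex) \<Rightarrow> 'v::ab_group_add"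
  where "lin_ext sc f X = (\<Sum>i\<in>Poly_Mapping.keys X. sc (Poly_Mapping.lookup X i) (f i))"

lemma lin_ext_single:
  assumes "vector_space sc"
  shows "lin_ext sc f (Poly_Mapping.single i 1) = f i"
proof -
  interpret vector_space sc by fact
  show ?thesis by (simp add: lin_ext_def)
qed

lemma linear_lin_ext:
  fixes f :: "'i \<Rightarrow> 'v::ab_group_add"
  assumes "vector_space sc"
  shows "Vector_Spaces.linear pm_scale sc (lin_ext sc f)"
proof -
  interpret v: vector_space sc by fact
  have ext: "lin_ext sc f X = (\<Sum>i\<in>K. sc (Poly_Mapping.lookup X i) (f i))"
    if "finite K" "Poly_Mapping.keys X \<subseteq> K" for X K
    unfolding lin_ext_def using that
    by (intro sum.mono_neutral_left) (auto simp: in_keys_iff)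
  show ?thesis
  proof unfold_locales
    fix X Y :: "'i \<Rightarrow>\<^sub>0 complex" and c :: complex
    let ?K = "Poly_Mapping.keys X \<union> Poly_Mapping.keys Y \<union> Poly_Mapping.keys (X + Y) \<union> Poly_Mapping.keys (pm_scale c X)"
    have K: "finite ?K" by simp
    show "lin_ext sc f (X + Y) = lin_ext sc f X + lin_ext sc f Y"
      by (subst (1 2 3) ext[OF K])
        (auto simp: lookup_add v.scale_left_distrib sum.distrib)
    show "lin_ext sc f (pm_scale c X) = sc c (lin_ext sc f X)"
      by (subst (1 2) ext[OF K]) (auto simp: v.scale_sum_right)
  qed
qed

lemma linear_pm_eq_lin_ext:
  assumes "Vector_Spaces.linear pm_scale sc T"
  shows "T X = lin_ext sc (\<lambda>i. T (Poly_Mapping.single i 1)) X"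
proof -
  interpret Vector_Spaces.linear pm_scale sc T by fact
  have "X = (\<Sum>i\<in>Poly_Mapping.keys X. pm_scale (Poly_Mapping.lookup X i) (Poly_Mapping.single i 1))"
    by (rule poly_mapping_eqI)
      (auto simp: lookup_sum lookup_single when_def in_keys_iff sum.delta if_distrib cong: if_cong)
  hence "T X = T (\<Sum>i\<in>Poly_Mapping.keys X. pm_scale (Poly_Mapping.lookup X i) (Poly_Mapping.single i 1))"
    by simp
  thus ?thesis by (simp add: sum scale lin_ext_def)
qed


section \<open>The Verma module and its Hilbert space completion\<close>

text \<open>The generators \<open>l\<^bsub>-1\<^esub>, l\<^bsub>0\<^esub>, l\<^bsub>1\<^esub>\<close> acting on \<open>V\<^sub>h = \<complex>[z]\<close>.\<close>

definition verma_lm1 :: "real \<Rightarrow> complex poly \<Rightarrow> complex poly" where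
  "verma_lm1 h p = [:0, 1:] * p"

definition verma_l0 :: "real \<Rightarrow> complex poly \<Rightarrow> complex poly" where
  "verma_l0 h p = [:0, 1:] * pderiv p + smult (of_real h) p"

definition verma_l1 :: "real \<Rightarrow> complex poly \<Rightarrow> complex poly" where
  "verma_l1 h p = [:0, 1:] * pderiv (pderiv p) + smult (2 * of_real h) (pderiv p)"

text \<open>
  The monomials are orthogonal with \<open>\<parallel>z\<^sup>n\<parallel>\<^sup>2 = n! (2h)\<^sub>n\<close>, normalized by \<open>\<parallel>1\<parallel> = 1\<close>. By the lemmas
  below this is, up to a scalar factor, the only form with \<open>l\<^sub>i\<^sup>* = l\<^bsub>-i\<^esub>\<close>.
\<close>

definition verma_weight :: "real \<Rightarrow> nat \<Rightarrow> real" where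
  "verma_weight h n = fact n * pochhammer (2 * h) n"

definition verma_inner :: "real \<Rightarrow> complex poly \<Rightarrow> complex poly \<Rightarrow> complex" where
  "verma_inner h p q =
     (\<Sum>n\<le>degree p. coeff p n * cnj (coeff q n) * of_real (verma_weight h n))"

lemma verma_weight_pos: "h > 0 \<Longrightarrow> verma_weight h n > 0"
  by (simp add: verma_weight_def pochhammer_pos)

lemma verma_weight_Suc:
  "verma_weight h (Suc n) = (real n + 1) * (real n + 2 * h) * verma_weight h n"
  by (simp add: verma_weight_def pochhammer_Suc algebra_simps)

lemma verma_inner_ext:
  assumes "degree p \<le> N"
  shows "verma_inner h p q = (\<Sum>n\<le>N. coeff p n * cnj (coeff q n) * of_real (verma_weight h n))"
  unfolding verma_inner_def using assms
  by (intro sum.mono_neutral_left) (auto simp: coeff_eq_0)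

lemma verma_inner_add_left: "verma_inner h (p + p') q = verma_inner h p q + verma_inner h p' q"
proof -
  let ?N = "max (degree p) (degree p')"
  have "degree (p + p') \<le> ?N" by (rule degree_add_le_max)
  thus ?thesis
    by (simp add: verma_inner_ext[of _ ?N] algebra_simps sum.distrib)
qed

lemma verma_inner_smult_left: "verma_inner h (smult c p) q = c * verma_inner h p q"
  by (simp add: verma_inner_ext[of _ "degree p"] degree_smult_le sum_distrib_left mult.assoc)

lemma verma_inner_cnj: "cnj (verma_inner h p q) = verma_inner h q p"
  by (simp add: verma_inner_ext[of _ "max (degree p) (degree q)"] mult_ac)

lemma verma_inner_pos:
  assumes "h > 0" "p \<noteq> 0"
  shows "Re (verma_inner h p p) > 0"
proof -
  have eq: "Re (verma_inner h p p) = (\<Sum>n\<le>degree p. (cmod (coeff p n))\<^sup>2 * verma_weight h n)"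
    by (simp add: verma_inner_def complex_mult_cnj cmod_power2 flip: power2_eq_square)
  show ?thesis unfolding eq
    using assms verma_weight_pos[OF assms(1)]
    by (intro sum_pos2[of _ "degree p"]) (auto simp: less_imp_le)
qed

lemma verma_inner_adjoint_lm1: "verma_inner h (verma_lm1 h p) q = verma_inner h p (verma_l1 h q)"
proof -
  have d: "degree (verma_lm1 h p) \<le> Suc (degree p)"
    by (simp add: verma_lm1_def degree_pCons_le)
  have c: "coeff (verma_l1 h q) n = of_real ((real n + 1) * (real n + 2 * h)) * coeff q (Suc n)" for n
    by (cases n) (auto simp: verma_l1_def coeff_pderiv coeff_pCons algebra_simps)
  show ?thesis
    by (simp only: verma_inner_ext[OF d] verma_inner_ext[OF order.refl[of "degree p"]] sum.atMost_Suc_shift)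
      (simp add: verma_lm1_def c verma_weight_Suc algebra_simps)
qed

lemma verma_inner_adjoint_l0: "verma_inner h (verma_l0 h p) q = verma_inner h p (verma_l0 h q)"
proof -
  have c: "coeff (verma_l0 h q) n = (of_nat n + of_real h) * coeff q n" for n and q
    by (cases n) (auto simp: verma_l0_def coeff_pderiv coeff_pCons algebra_simps)
  have d: "degree (verma_l0 h p) \<le> degree p"
    by (rule degree_le) (auto simp: c coeff_eq_0)
  show ?thesis
    by (simp only: verma_inner_ext[OF d] verma_inner_ext[OF order.refl[of "degree p"]])
      (simp add: c algebra_simps)
qed

lemma verma_inner_unique:
  assumes add_l: "\<And>p p' q. B (p + p') q = B p q + B p' q"
    and smult_l: "\<And>c p q. B (smult c p) q = c * B p q"
    and cnj: "\<And>p q. cnj (B p q) = B q p"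
    and adj: "\<And>p q. B (verma_lm1 h p) q = B p (verma_l1 h q)"
  shows "B p q = B 1 1 * verma_inner h p q"
proof -
  have split: "pCons a p = smult a 1 + verma_lm1 h p" for a and p :: "complex poly"
    by (simp add: verma_lm1_def)
  have l1: "verma_l1 h 1 = 0" by (simp add: verma_l1_def)
  have one: "B' 1 q = cnj (coeff q 0) * B' 1 1"
    if a: "\<And>p p' q. B' (p + p') q = B' p q + B' p' q"
      and s: "\<And>c p q. B' (smult c p) q = c * B' p q"
      and c: "\<And>p q. cnj (B' p q) = B' q p"
      and adj: "\<And>p q. B' (verma_lm1 h p) q = B' p (verma_l1 h q)"
    for B' :: "complex poly \<Rightarrow> complex poly \<Rightarrow> complex" and q
  proof -
    obtain b r where q: "q = pCons b r" by (cases q)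
    have 0: "B' p 0 = 0" for p
      using s[of 0 0 p] c[of 0 p] by simp
    have "B' q 1 = b * B' 1 1 + B' r (verma_l1 h 1)"
      unfolding q split a s adj ..
    also have "\<dots> = b * B' 1 1" by (simp add: l1 0)
    finally have "B' 1 q = cnj (b * B' 1 1)" by (metis c)
    thus ?thesis using c[of 1 1] by (simp add: q)
  qed
  have 11: "verma_inner h 1 1 = 1"
    by (simp add: verma_inner_def verma_weight_def)
  show ?thesis
  proof (induction p arbitrary: q)
    case 0
    show ?case using smult_l[of 0 0 q] by (simp add: verma_inner_def)
  next
    case (pCons a p)
    have "B 1 q = B 1 1 * verma_inner h 1 q"
      using one[of B q, OF add_l smult_l cnj adj]
        one[of "verma_inner h" q, OF verma_inner_add_left verma_inner_smult_left
          verma_inner_cnj verma_inner_adjoint_lm1]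
      by (simp add: 11)
    thus ?case
      unfolding split add_l smult_l adj verma_inner_add_left verma_inner_smult_left
        verma_inner_adjoint_lm1 pCons.IH
      by (simp add: algebra_simps)
  qed
qed

text \<open>
  The completion of \<open>V\<^sub>h\<close> (\<open>h > 0\<close>) consists of the formal power series of finite norm;
  polynomials are embedded by \<open>fps_of_poly\<close>.
\<close>

definition verma_hilbert :: "real \<Rightarrow> complex fps set" where
  "verma_hilbert h = {f. summable (\<lambda>n. (cmod (fps_nth f n))\<^sup>2 * verma_weight h n)}"

definition verma_norm :: "real \<Rightarrow> complex fps \<Rightarrow> real" where
  "verma_norm h f = sqrt (suminf (\<lambda>n. (cmod (fps_nth f n))\<^sup>2 * verma_weight h n))"

lemma verma_hilbert_poly:
  "fps_of_poly p \<in> verma_hilbert h"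
  "verma_norm h (fps_of_poly p) = sqrt (Re (verma_inner h p p))"
proof -
  have s: "(\<lambda>n. (cmod (coeff p n))\<^sup>2 * verma_weight h n) sums
      (\<Sum>n\<le>degree p. (cmod (coeff p n))\<^sup>2 * verma_weight h n)"
    by (rule sums_finite) (auto simp: coeff_eq_0)
  thus "fps_of_poly p \<in> verma_hilbert h"
    by (auto simp: verma_hilbert_def sums_iff)
  have "Re (verma_inner h p p) = (\<Sum>n\<le>degree p. (cmod (coeff p n))\<^sup>2 * verma_weight h n)"
    by (simp add: verma_inner_def complex_mult_cnj cmod_power2 flip: power2_eq_square)
  thus "verma_norm h (fps_of_poly p) = sqrt (Re (verma_inner h p p))"
    using s by (simp add: verma_norm_def sums_iff)
qed

lemma verma_hilbert_diff:
  assumes "h > 0" "f \<in> verma_hilbert h" "g \<in> verma_hilbert h"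
  shows "f - g \<in> verma_hilbert h"
proof -
  have "summable (\<lambda>n. 2 * ((cmod (fps_nth f n))\<^sup>2 * verma_weight h n) +
      2 * ((cmod (fps_nth g n))\<^sup>2 * verma_weight h n))"
    using assms by (intro summable_add summable_mult) (auto simp: verma_hilbert_def)
  moreover have "norm ((cmod (fps_nth (f - g) n))\<^sup>2 * verma_weight h n) \<le>
      2 * ((cmod (fps_nth f n))\<^sup>2 * verma_weight h n) +
      2 * ((cmod (fps_nth g n))\<^sup>2 * verma_weight h n)" for n
  proof -
    have "(cmod (fps_nth (f - g) n))\<^sup>2 \<le> (cmod (fps_nth f n) + cmod (fps_nth g n))\<^sup>2"
      by (intro power_mono) (auto simp: norm_triangle_ineq4)
    also have "\<dots> \<le> 2 * (cmod (fps_nth f n))\<^sup>2 + 2 * (cmod (fps_nth g n))\<^sup>2"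
      using sum_squares_bound[of "cmod (fps_nth f n)" "cmod (fps_nth g n)"]
      by (simp add: power2_sum)
    finally have "(cmod (fps_nth (f - g) n))\<^sup>2 * verma_weight h n \<le>
        (2 * (cmod (fps_nth f n))\<^sup>2 + 2 * (cmod (fps_nth g n))\<^sup>2) * verma_weight h n"
      using verma_weight_pos[OF assms(1), of n] by (intro mult_right_mono) auto
    thus ?thesis using verma_weight_pos[OF assms(1), of n] by (simp add: algebra_simps abs_mult)
  qed
  ultimately show ?thesis
    unfolding verma_hilbert_def mem_Collect_eq by (rule summable_comparison_test'[where N = 0])
qed

lemma verma_hilbert_dense:
  assumes "h > 0" "f \<in> verma_hilbert h" "e > 0"
  shows "\<exists>p. verma_norm h (f - fps_of_poly p) < e"
proof -
  let ?a = "\<lambda>n. (cmod (fps_nth f n))\<^sup>2 * verma_weight h n"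
  have s: "summable ?a" using assms by (simp add: verma_hilbert_def)
  from suminf_exist_split[OF _ s, of "e\<^sup>2"] assms(3)
  obtain N where N: "\<And>n. n \<ge> N \<Longrightarrow> norm (suminf (\<lambda>i. ?a (i + n))) < e\<^sup>2" by (auto simp: zero_less_power)
  define p where "p = (\<Sum>n<N. monom (fps_nth f n) n)"
  have cp: "coeff p n = (if n < N then fps_nth f n else 0)" for n
    by (simp add: p_def coeff_sum coeff_monom)
  let ?b = "\<lambda>n. (cmod (fps_nth (f - fps_of_poly p) n))\<^sup>2 * verma_weight h n"
  have b: "?b = (\<lambda>n. if n < N then 0 else ?a n)" by (auto simp: cp)
  have "f - fps_of_poly p \<in> verma_hilbert h"
    using assms by (intro verma_hilbert_diff verma_hilbert_poly)
  hence "summable ?b" by (simp add: verma_hilbert_def)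
  hence "suminf ?b = suminf (\<lambda>i. ?b (i + N)) + (\<Sum>i<N. ?b i)" by (rule suminf_split_initial_segment)
  also have "\<dots> = suminf (\<lambda>i. ?a (i + N))" by (simp add: cp)
  also have "\<dots> < e\<^sup>2" using N[of N] by auto
  finally have "verma_norm h (f - fps_of_poly p) < sqrt (e\<^sup>2)"
    unfolding verma_norm_def by (subst real_sqrt_less_iff)
  thus ?thesis using assms(3) by auto
qed

lemma verma_hilbert_complete:
  assumes h: "h > 0" and F: "\<And>m. F m \<in> verma_hilbert h"
    and cauchy: "\<And>e. e > 0 \<Longrightarrow> \<exists>N. \<forall>m\<ge>N. \<forall>n\<ge>N. verma_norm h (F m - F n) < e"
  shows "\<exists>f\<in>verma_hilbert h. (\<lambda>m. verma_norm h (F m - f)) \<longlonglongrightarrow> 0"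
proof -
  have part: "(\<Sum>j<J. (cmod (fps_nth g j))\<^sup>2 * verma_weight h j) \<le> (verma_norm h g)\<^sup>2"
    if "g \<in> verma_hilbert h" for g J
  proof -
    have nn: "0 \<le> (cmod (fps_nth g j))\<^sup>2 * verma_weight h j" for j
      using verma_weight_pos[OF h, of j] by simp
    have "(\<Sum>j<J. (cmod (fps_nth g j))\<^sup>2 * verma_weight h j) \<le>
        suminf (\<lambda>j. (cmod (fps_nth g j))\<^sup>2 * verma_weight h j)"
      using that nn by (intro sum_le_suminf) (auto simp: verma_hilbert_def)
    thus ?thesis
      using suminf_nonneg[OF _ nn] that
      by (simp add: verma_norm_def verma_hilbert_def)
  qed
  have nn0: "verma_norm h g \<ge> 0" if "g \<in> verma_hilbert h" for g
    using that verma_weight_pos[OF h]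
    by (auto simp: verma_norm_def verma_hilbert_def less_imp_le intro!: suminf_nonneg)
  have D: "F m - F n \<in> verma_hilbert h" for m n by (intro verma_hilbert_diff h F)
  have "Cauchy (\<lambda>m. fps_nth (F m) j)" for j
  proof (rule CauchyI)
    fix e :: real assume e: "e > 0"
    let ?w = "sqrt (verma_weight h j)"
    have w: "?w > 0" using verma_weight_pos[OF h] by simp
    obtain N where N: "\<And>m n. m \<ge> N \<Longrightarrow> n \<ge> N \<Longrightarrow> verma_norm h (F m - F n) < e * ?w"
      using cauchy[of "e * ?w"] e w by auto
    have "cmod (fps_nth (F m) j - fps_nth (F n) j) < e" if "m \<ge> N" "n \<ge> N" for m n
    proof -
      have "(cmod (fps_nth (F m - F n) j))\<^sup>2 * verma_weight h j \<le>
          (\<Sum>i<Suc j. (cmod (fps_nth (F m - F n) i))\<^sup>2 * verma_weight h i)"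
        using verma_weight_pos[OF h] by (intro member_le_sum) (auto simp: less_imp_le)
      also have "\<dots> \<le> (verma_norm h (F m - F n))\<^sup>2" by (rule part[OF D])
      finally have "(cmod (fps_nth (F m - F n) j) * ?w)\<^sup>2 \<le> (verma_norm h (F m - F n))\<^sup>2"
        using verma_weight_pos[OF h, of j] by (simp add: power_mult_distrib)
      hence "cmod (fps_nth (F m - F n) j) * ?w \<le> verma_norm h (F m - F n)"
        using nn0[OF D] power2_le_imp_le by blast
      also have "\<dots> < e * ?w" by (rule N[OF that])
      finally show ?thesis using w by simp
    qed
    thus "\<exists>M. \<forall>m\<ge>M. \<forall>n\<ge>M. norm (fps_nth (F m) j - fps_nth (F n) j) < e" by blast
  qed
  hence "\<exists>l. (\<lambda>m. fps_nth (F m) j) \<longlonglongrightarrow> l" for j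
    by (simp add: Cauchy_convergent_iff convergent_def)
  then obtain l where l: "\<And>j. (\<lambda>m. fps_nth (F m) j) \<longlonglongrightarrow> l j" by metis
  define f where "f = Abs_fps l"
  have close: "F m - f \<in> verma_hilbert h \<and> verma_norm h (F m - f) \<le> e"
    if e: "e > 0" and N: "\<And>n. n \<ge> N \<Longrightarrow> verma_norm h (F m - F n) < e" for m e N
  proof -
    let ?t = "\<lambda>j. (cmod (fps_nth (F m - f) j))\<^sup>2 * verma_weight h j"
    have le: "(\<Sum>j<J. ?t j) \<le> e\<^sup>2" for J
    proof (rule tendsto_upperbound)
      show "(\<lambda>n. \<Sum>j<J. (cmod (fps_nth (F m - F n) j))\<^sup>2 * verma_weight h j)
          \<longlonglongrightarrow> (\<Sum>j<J. ?t j)"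
        unfolding f_def by (auto intro!: tendsto_intros l)
      show "\<forall>\<^sub>F n in sequentially.
          (\<Sum>j<J. (cmod (fps_nth (F m - F n) j))\<^sup>2 * verma_weight h j) \<le> e\<^sup>2"
        using eventually_ge_at_top[of N]
      proof eventually_elim
        case (elim n)
        have "(verma_norm h (F m - F n))\<^sup>2 \<le> e\<^sup>2"
          using N[OF elim] nn0[OF D] by (intro power_mono) auto
        thus ?case using part[OF D[of m n], of J] by linarith
      qed
    qed simp
    have tn: "0 \<le> ?t j" for j using verma_weight_pos[OF h, of j] by simp
    have s: "summable ?t"
      by (rule bounded_imp_summable[of _ "e\<^sup>2"]) (use tn le[of "Suc _"] in \<open>auto simp: lessThan_Suc_atMost\<close>)
    have "suminf ?t \<le> e\<^sup>2" by (intro suminf_le_const s le)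
    hence "sqrt (suminf ?t) \<le> e" using e real_le_lsqrt[of e "suminf ?t"]
      by (simp add: real_sqrt_le_iff' real_le_lsqrt)
    thus ?thesis using s by (simp add: verma_hilbert_def verma_norm_def)
  qed
  obtain N1 where N1: "\<And>n. n \<ge> N1 \<Longrightarrow> verma_norm h (F N1 - F n) < 1"
    using cauchy[of 1] by auto
  have "F N1 - (F N1 - f) \<in> verma_hilbert h"
    using close[of 1 N1 N1, OF _ N1] by (rule verma_hilbert_diff[OF h F, OF conjunct1]) simp
  hence f: "f \<in> verma_hilbert h" by simp
  have "(\<lambda>m. verma_norm h (F m - f)) \<longlonglongrightarrow> 0"
  proof (rule LIMSEQ_I)
    fix e :: real assume e: "e > 0"
    obtain N where N: "\<And>m n. m \<ge> N \<Longrightarrow> n \<ge> N \<Longrightarrow> verma_norm h (F m - F n) < e / 2"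
      using cauchy[of "e / 2"] e by auto
    have "norm (verma_norm h (F m - f) - 0) < e" if "m \<ge> N" for m
      using close[of "e / 2" N m] N that e nn0[of "F m - f"] by force
    thus "\<exists>no. \<forall>m\<ge>no. norm (verma_norm h (F m - f) - 0) < e" by blast
  qed
  thus ?thesis using f by blast
qed


section \<open>Hilbert--Schmidt and finite-rank operators\<close>

text \<open>Values of \<open>A\<close> outside \<open>verma_hilbert h\<close> are irrelevant.\<close>

definition bounded_operator :: "real \<Rightarrow> (complex fps \<Rightarrow> complex fps) \<Rightarrow> bool" where
  "bounded_operator h A \<longleftrightarrow>
     (\<forall>f\<in>verma_hilbert h. A f \<in> verma_hilbert h) \<and>
     (\<forall>f\<in>verma_hilbert h. \<forall>g\<in>verma_hilbert h. A (f + g) = A f + A g) \<and>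
     (\<forall>c. \<forall>f\<in>verma_hilbert h. A (fps_scale c f) = fps_scale c (A f)) \<and>
     (\<exists>K. \<forall>f\<in>verma_hilbert h. verma_norm h (A f) \<le> K * verma_norm h f)"

text \<open>The orthonormal basis \<open>z\<^sup>n / \<parallel>z\<^sup>n\<parallel>\<close>.\<close>

definition verma_onb :: "real \<Rightarrow> nat \<Rightarrow> complex fps" where
  "verma_onb h n = fps_scale (of_real (1 / sqrt (verma_weight h n))) (fps_X ^ n)"

definition hilbert_schmidt :: "real \<Rightarrow> (complex fps \<Rightarrow> complex fps) \<Rightarrow> bool" where
  "hilbert_schmidt h A \<longleftrightarrow>
     bounded_operator h A \<and> summable (\<lambda>n. (verma_norm h (A (verma_onb h n)))\<^sup>2)"

definition finite_rank :: "real \<Rightarrow> (complex fps \<Rightarrow> complex fps) \<Rightarrow> bool" where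
  "finite_rank h A \<longleftrightarrow>
     bounded_operator h A \<and> (\<exists>B. finite B \<and> A ` verma_hilbert h \<subseteq> fps_vs.span B)"

definition extends_to ::
    "(complex poly \<Rightarrow> complex poly) \<Rightarrow> (complex fps \<Rightarrow> complex fps) \<Rightarrow> bool" where
  "extends_to S A \<longleftrightarrow> (\<forall>p. A (fps_of_poly p) = fps_of_poly (S p))"

definition HS :: "real \<Rightarrow> (complex poly \<Rightarrow> complex poly) set" where
  "HS h = {S. \<exists>A. extends_to S A \<and> hilbert_schmidt h A}"

definition FR :: "real \<Rightarrow> (complex poly \<Rightarrow> complex poly) set" where
  "FR h = {S. \<exists>A. extends_to S A \<and> finite_rank h A}"


section \<open>Lie algebras and projective representations\<close>

definition lie_algebra :: "(complex \<Rightarrow> 'g \<Rightarrow> 'g) \<Rightarrow> ('g \<Rightarrow> 'g \<Rightarrow> 'g::ab_group_add) \<Rightarrow> bool" where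
  "lie_algebra sc br \<longleftrightarrow>
     vector_space sc \<and>
     (\<forall>X. Vector_Spaces.linear sc sc (br X)) \<and>
     (\<forall>Y. Vector_Spaces.linear sc sc (\<lambda>X. br X Y)) \<and>
     (\<forall>X. br X X = 0) \<and>
     (\<forall>X Y Z. br X (br Y Z) + br Y (br Z X) + br Z (br X Y) = 0)"

definition projective_rep ::
    "(complex poly \<Rightarrow> complex poly) set \<Rightarrow> (complex \<Rightarrow> 'g \<Rightarrow> 'g) \<Rightarrow> ('g \<Rightarrow> 'g \<Rightarrow> 'g::ab_group_add)
      \<Rightarrow> ('g \<Rightarrow> complex poly \<Rightarrow> complex poly) \<Rightarrow> bool" where
  "projective_rep \<AA> sc br T \<longleftrightarrow>
     lie_algebra sc br \<and>
     (\<forall>X. Vector_Spaces.linear smult smult (T X)) \<and>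
     (\<forall>p. Vector_Spaces.linear sc smult (\<lambda>X. T X p)) \<and>
     (\<forall>X Y. (\<lambda>p. T X (T Y p) - T Y (T X p) - T (br X Y) p) \<in> \<AA>)"

text \<open>Bilinear extension of a bracket, and linear extension of operators, given on a basis.\<close>

definition bracket_ext ::
    "('i \<Rightarrow> 'i \<Rightarrow> ('i \<Rightarrow>\<^sub>0 complex)) \<Rightarrow> ('i \<Rightarrow>\<^sub>0 complex) \<Rightarrow> ('i \<Rightarrow>\<^sub>0 complex) \<Rightarrow> ('i \<Rightarrow>\<^sub>0 complex)" where
  "bracket_ext b X Y = lin_ext pm_scale (\<lambda>i. lin_ext pm_scale (b i) Y) X"

definition rep_ext ::
    "('i \<Rightarrow> complex poly \<Rightarrow> complex poly) \<Rightarrow> ('i \<Rightarrow>\<^sub>0 complex) \<Rightarrow> complex poly \<Rightarrow> complex poly" where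
  "rep_ext t X p = lin_ext smult (\<lambda>i. t i p) X"

lemma bracket_ext_single:
  "bracket_ext b (Poly_Mapping.single i 1) (Poly_Mapping.single j 1) = b i j"
  by (simp add: bracket_ext_def lin_ext_single pm_vs.vector_space_axioms)

lemma rep_ext_single: "rep_ext t (Poly_Mapping.single i 1) = t i"
  by (rule ext) (simp add: rep_ext_def lin_ext_single poly_vs.vector_space_axioms)

lemma linear_bracket_ext_left: "Vector_Spaces.linear pm_scale pm_scale (\<lambda>X. bracket_ext b X Y)"
  unfolding bracket_ext_def by (rule linear_lin_ext) unfold_locales

lemma linear_bracket_ext_right: "Vector_Spaces.linear pm_scale pm_scale (bracket_ext b X)"
proof -
  interpret l: Vector_Spaces.linear pm_scale pm_scale "lin_ext pm_scale (b i)" for i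
    by (rule linear_lin_ext) unfold_locales
  show ?thesis
    by unfold_locales
      (simp_all add: bracket_ext_def lin_ext_def[of _ _ X] l.add l.scale pm_vs.scale_right_distrib
        sum.distrib pm_vs.scale_sum_right mult.commute)
qed

lemma lie_algebra_bracket_ext:
  fixes b :: "'i \<Rightarrow> 'i \<Rightarrow> ('i \<Rightarrow>\<^sub>0 complex)"
  assumes skew: "\<And>i j. b i j = - b j i"
    and jacobi: "\<And>i j k. lin_ext pm_scale (b i) (b j k) + lin_ext pm_scale (b j) (b k i)
                   + lin_ext pm_scale (b k) (b i j) = 0"
  shows "lie_algebra pm_scale (bracket_ext b)"
proof -
  let ?s = "\<lambda>i. Poly_Mapping.single i (1 :: complex) :: 'i \<Rightarrow>\<^sub>0 complex"
  interpret L: Vector_Spaces.linear pm_scale pm_scale "\<lambda>X. bracket_ext b X Y" for Y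
    by (rule linear_bracket_ext_left)
  interpret R: Vector_Spaces.linear pm_scale pm_scale "bracket_ext b X" for X
    by (rule linear_bracket_ext_right)
  have zero: "f X = 0" if "Vector_Spaces.linear pm_scale pm_scale f" "\<And>i. f (?s i) = 0"
    for f :: "('i \<Rightarrow>\<^sub>0 complex) \<Rightarrow> ('i \<Rightarrow>\<^sub>0 complex)" and X
    by (subst linear_pm_eq_lin_ext[OF that(1)]) (simp add: that(2) lin_ext_def)
  have left: "bracket_ext b (?s i) Y = lin_ext pm_scale (b i) Y" for i Y
    by (simp add: bracket_ext_def lin_ext_single pm_vs.vector_space_axioms)
  have anti: "bracket_ext b X Y + bracket_ext b Y X = 0" for X Y
  proof (rule zero[of "\<lambda>X. bracket_ext b X Y + bracket_ext b Y X"])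
    show "Vector_Spaces.linear pm_scale pm_scale (\<lambda>X. bracket_ext b X Y + bracket_ext b Y X)" for Y
      by unfold_locales (simp_all add: L.add R.add L.scale R.scale pm_vs.scale_right_distrib)
    fix i
    show "bracket_ext b (?s i) Y + bracket_ext b Y (?s i) = 0"
    proof (rule zero[of "\<lambda>Y. bracket_ext b (?s i) Y + bracket_ext b Y (?s i)"])
      show "Vector_Spaces.linear pm_scale pm_scale (\<lambda>Y. bracket_ext b (?s i) Y + bracket_ext b Y (?s i))"
        by unfold_locales (simp_all add: L.add R.add L.scale R.scale pm_vs.scale_right_distrib)
      show "bracket_ext b (?s i) (?s j) + bracket_ext b (?s j) (?s i) = 0" for j
        using skew[of i j] by (simp add: bracket_ext_single)
    qed
  qed
  have alt: "bracket_ext b X X = 0" for X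
  proof -
    have "pm_scale 2 (bracket_ext b X X) = 0"
      using anti[of X X] pm_vs.scale_left_distrib[of 1 1 "bracket_ext b X X"] by simp
    thus ?thesis by simp
  qed
  let ?J = "\<lambda>X Y Z. bracket_ext b X (bracket_ext b Y Z) + bracket_ext b Y (bracket_ext b Z X)
              + bracket_ext b Z (bracket_ext b X Y)"
  have J: "?J X Y Z = 0" for X Y Z
  proof (rule zero[of "\<lambda>X. ?J X Y Z"])
    show "Vector_Spaces.linear pm_scale pm_scale (\<lambda>X. ?J X Y Z)"
      by unfold_locales (simp_all add: L.add R.add L.scale R.scale pm_vs.scale_right_distrib)
    show "?J (?s i) Y Z = 0" for i
    proof (rule zero[of "\<lambda>Y. ?J (?s i) Y Z"])
      show "Vector_Spaces.linear pm_scale pm_scale (\<lambda>Y. ?J (?s i) Y Z)"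
        by unfold_locales (simp_all add: L.add R.add L.scale R.scale pm_vs.scale_right_distrib)
      show "?J (?s i) (?s j) Z = 0" for j
      proof (rule zero[of "\<lambda>Z. ?J (?s i) (?s j) Z"])
        show "Vector_Spaces.linear pm_scale pm_scale (\<lambda>Z. ?J (?s i) (?s j) Z)"
          by unfold_locales (simp_all add: L.add R.add L.scale R.scale pm_vs.scale_right_distrib)
        show "?J (?s i) (?s j) (?s k) = 0" for k
          using jacobi[of i j k] by (simp only: bracket_ext_single left)
      qed
    qed
  qed
  show ?thesis
    unfolding lie_algebra_def
    using pm_vs.vector_space_axioms linear_bracket_ext_left linear_bracket_ext_right alt J by blast
qed


section \<open>The Witt algebra and its semidirect sum with the Heisenberg algebra\<close>

definition witt_b :: "int \<Rightarrow> int \<Rightarrow> (int \<Rightarrow>\<^sub>0 complex)" where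
  "witt_b j k = Poly_Mapping.single (j + k) (of_int (j - k))"

definition witt_bracket :: "(int \<Rightarrow>\<^sub>0 complex) \<Rightarrow> (int \<Rightarrow>\<^sub>0 complex) \<Rightarrow> (int \<Rightarrow>\<^sub>0 complex)" where
  "witt_bracket = bracket_ext witt_b"

datatype wh_basis = E int | Heis int | Cent

fun wh_b :: "wh_basis \<Rightarrow> wh_basis \<Rightarrow> (wh_basis \<Rightarrow>\<^sub>0 complex)" where
  "wh_b (E j) (E k) = Poly_Mapping.single (E (j + k)) (of_int (j - k))"
| "wh_b (E n) (Heis k) = Poly_Mapping.single (Heis (n + k)) (- of_int k)"
| "wh_b (Heis k) (E n) = Poly_Mapping.single (Heis (n + k)) (of_int k)"
| "wh_b (Heis n) (Heis m) = (if n + m = 0 then Poly_Mapping.single Cent (of_int n) else 0)"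
| "wh_b Cent _ = 0"
| "wh_b _ Cent = 0"

definition wh_bracket ::
    "(wh_basis \<Rightarrow>\<^sub>0 complex) \<Rightarrow> (wh_basis \<Rightarrow>\<^sub>0 complex) \<Rightarrow> (wh_basis \<Rightarrow>\<^sub>0 complex)" where
  "wh_bracket = bracket_ext wh_b"

lemma lin_ext_pm_single: "lin_ext pm_scale f (Poly_Mapping.single i c) = pm_scale c (f i)"
  by (simp add: lin_ext_def)

lemma lin_ext_pm_zero: "lin_ext pm_scale f 0 = 0"
  by (simp add: lin_ext_def)

lemma pm_scale_single: "pm_scale c (Poly_Mapping.single i d) = Poly_Mapping.single i (c * d)"
  by (rule poly_mapping_eqI) (simp add: lookup_single when_def)

lemma lie_algebra_witt: "lie_algebra pm_scale witt_bracket"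
  unfolding witt_bracket_def
proof (rule lie_algebra_bracket_ext)
  show "witt_b i j = - witt_b j i" for i j
    by (simp add: witt_b_def add.commute flip: single_uminus)
  show "lin_ext pm_scale (witt_b i) (witt_b j k) + lin_ext pm_scale (witt_b j) (witt_b k i)
      + lin_ext pm_scale (witt_b k) (witt_b i j) = 0" for i j k
    by (simp add: witt_b_def lin_ext_pm_single pm_scale_single algebra_simps flip: single_add)
qed

lemma lie_algebra_wh: "lie_algebra pm_scale wh_bracket"
  unfolding wh_bracket_def
proof (rule lie_algebra_bracket_ext)
  show "wh_b i j = - wh_b j i" for i j
    by (cases i; cases j) (auto simp: add.commute minus_equation_iff simp flip: single_uminus
        of_int_minus intro!: arg_cong[where f = "Poly_Mapping.single Cent"])
  show "lin_ext pm_scale (wh_b i) (wh_b j k) + lin_ext pm_scale (wh_b j) (wh_b k i)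
      + lin_ext pm_scale (wh_b k) (wh_b i j) = 0" for i j k
    by (cases i; cases j; cases k)
      (auto simp: lin_ext_pm_single lin_ext_pm_zero pm_scale_single algebra_simps
        simp flip: single_add of_int_mult of_int_add of_int_diff of_int_minus)
qed


section \<open>The operators\<close>

text \<open>\<open>xi_fun f\<close> is \<open>f(\<xi>)\<close> with \<open>\<xi> = z \<partial>\<^sub>z\<close>, i.e. \<open>f(\<xi>) z\<^sup>n = f(n) z\<^sup>n\<close>.\<close>

definition xi_fun :: "(complex \<Rightarrow> complex) \<Rightarrow> complex poly \<Rightarrow> complex poly" where
  "xi_fun f p = (\<Sum>n\<le>degree p. monom (f (of_nat n) * coeff p n) n)"

lemma coeff_xi_fun: "coeff (xi_fun f p) n = f (of_nat n) * coeff p n"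
  by (simp add: xi_fun_def coeff_sum coeff_monom coeff_eq_0)

definition opL :: "real \<Rightarrow> int \<Rightarrow> complex poly \<Rightarrow> complex poly" where
  "opL h k p =
     (if k \<ge> 0 then xi_fun (\<lambda>\<xi>. \<xi> + of_int (k + 1) * of_real h) ((pderiv ^^ nat k) p)
      else let m = nat (- k) in
        monom 1 m * xi_fun (\<lambda>\<xi>. (\<xi> + of_nat (m + 1) * of_real h) / (\<Prod>i<m. \<xi> + 2 * of_real h + of_nat i)) p)"

definition opF :: "real \<Rightarrow> complex poly \<Rightarrow> complex poly" where
  "opF h p = [:0, 1:] * xi_fun (\<lambda>\<xi>. 1 / (\<xi> + 2 * of_real h)) p"

definition opJ :: "real \<Rightarrow> int \<Rightarrow> complex poly \<Rightarrow> complex poly" where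
  "opJ h k = (if k \<ge> 0 then pderiv ^^ nat k else opF h ^^ nat (- k))"

definition witt_rep :: "real \<Rightarrow> (int \<Rightarrow>\<^sub>0 complex) \<Rightarrow> complex poly \<Rightarrow> complex poly" where
  "witt_rep h = rep_ext (opL h)"

definition wh_rep :: "real \<Rightarrow> (wh_basis \<Rightarrow>\<^sub>0 complex) \<Rightarrow> complex poly \<Rightarrow> complex poly" where
  "wh_rep h = rep_ext (\<lambda>x. case x of E k \<Rightarrow> opL h k | Heis k \<Rightarrow> opJ h k | Cent \<Rightarrow> (\<lambda>p. 0))"

text \<open>\<open>L\<^sub>i = l\<^sub>i\<close> for \<open>i = -1, 0, 1\<close>.\<close>

lemma opL_sl2:
  assumes "h > 0"
  shows "opL h (-1) = verma_lm1 h" "opL h 0 = verma_l0 h" "opL h 1 = verma_l1 h"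
proof -
  have nz: "of_nat n + 2 * complex_of_real h \<noteq> 0" for n
  proof
    assume "of_nat n + 2 * complex_of_real h = 0"
    hence "Re (of_nat n + 2 * complex_of_real h) = 0" by simp
    thus False using assms by simp
  qed
  have "xi_fun (\<lambda>\<xi>. (\<xi> + 2 * of_real h) / (\<xi> + 2 * of_real h)) p = p" for p
    by (rule poly_eqI) (simp add: coeff_xi_fun nz)
  thus "opL h (-1) = verma_lm1 h"
    by (intro ext) (simp add: opL_def verma_lm1_def monom_altdef)
  show "opL h 0 = verma_l0 h"
    by (intro ext poly_eqI)
      (auto simp: opL_def verma_l0_def coeff_xi_fun coeff_pCons coeff_pderiv algebra_simps split: nat.split)
  show "opL h 1 = verma_l1 h"
    by (intro ext poly_eqI)
      (auto simp: opL_def verma_l1_def coeff_xi_fun coeff_pCons coeff_pderiv algebra_simps split: nat.split)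
qed

end

theory Submission
  imports Defs
begin

text \<open>
  In the basis \<open>u\<^sub>n = z\<^sup>n / (2h)\<^sub>n\<close> the operator \<open>L\<^sub>k\<close> with \<open>k < 0\<close> acts, for every \<open>h > 0\<close>, by
  \<open>u\<^sub>n \<mapsto> (n + (1 - k) h) u\<^bsub>n-k\<^esub>\<close>. For \<open>h = 1/2\<close> and \<open>h = 1\<close> the same formula also holds for
  \<open>k \<ge> 0\<close>, with \<open>u\<^sub>m = 0\<close> for \<open>m < 0\<close> (\<open>opL_density_basis\<close>), and for \<open>h = 1/2\<close> moreover
  \<open>J\<^sub>k u\<^sub>n = u\<^bsub>n-k\<^esub>\<close> (\<open>opJ_density_basis\<close>). If \<open>n\<close> ranged over all integers, these formulas
  would define an honest representation of the Witt algebra on densities on the circle, together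
  with the multiplication operators by Laurent monomials. So the \<open>L\<^sub>k\<close> and \<open>J\<^sub>k\<close> are the compressions
  of a genuine representation to the half line \<open>n \<ge> 0\<close>, and a bracket relation can fail on \<open>u\<^sub>n\<close>
  only if \<open>u\<^sub>n\<close> is shifted across \<open>0\<close>, that is, only for finitely many \<open>n\<close>.

  Hence the defect \<open>[T X, T Y] - T [X, Y]\<close> of two basis elements kills almost all monomials. By
  bilinearity (\<open>projective_rep_rep_ext\<close>) this carries over to all \<open>X\<close> and \<open>Y\<close>. A linear operator
  that kills almost all monomials extends to the completion by a finite sum of coefficient
  functionals, which are bounded, so that it has finite rank and is Hilbert--Schmidt
  (\<open>eventually_vanishing_extension\<close>).
\<close>

section \<open>Linear operators on polynomials\<close>

abbreviation poly_linear :: "(complex poly \<Rightarrow> complex poly) \<Rightarrow> bool" where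
  "poly_linear \<equiv> Vector_Spaces.linear smult smult"

lemma poly_linearI:
  assumes "\<And>p q. S (p + q) = S p + S q" "\<And>c p. S (smult c p) = smult c (S p)"
  shows "poly_linear S"
  by unfold_locales (use assms in auto)

lemma poly_linear_add: "poly_linear S \<Longrightarrow> S (p + q) = S p + S q"
  and poly_linear_smult: "poly_linear S \<Longrightarrow> S (smult c p) = smult c (S p)"
  by (auto simp: Vector_Spaces.linear_iff)

lemma poly_linear_0: "poly_linear S \<Longrightarrow> S 0 = 0"
  using poly_linear_smult[of S 0 0] by simp

lemma poly_linear_sum: "poly_linear S \<Longrightarrow> S (sum f A) = (\<Sum>i\<in>A. S (f i))"
  by (induction A rule: infinite_finite_induct) (auto simp: poly_linear_0 poly_linear_add)

lemma poly_linear_eq_sum: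
  assumes "poly_linear S" "degree p \<le> N"
  shows "S p = (\<Sum>n\<le>N. smult (coeff p n) (S (monom 1 n)))"
proof -
  have "S p = S (\<Sum>n\<le>N. monom (coeff p n) n)"
    using assms(2) by (simp add: poly_as_sum_of_monoms')
  also have "\<dots> = (\<Sum>n\<le>N. S (smult (coeff p n) (monom 1 n)))"
    by (simp add: poly_linear_sum[OF assms(1)] smult_monom)
  finally show ?thesis by (simp add: poly_linear_smult[OF assms(1)])
qed

lemma poly_linear_rep_ext:
  assumes "\<And>i. poly_linear (t i)"
  shows "poly_linear (rep_ext t X)"
  by (rule poly_linearI)
    (simp_all add: rep_ext_def lin_ext_def poly_linear_add[OF assms] poly_linear_smult[OF assms]
      smult_add_right sum.distrib poly_vs.scale_sum_right mult.commute)

lemma linear_rep_ext_left: "Vector_Spaces.linear pm_scale smult (\<lambda>X. rep_ext t X p)"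
  unfolding rep_ext_def by (rule linear_lin_ext) (rule poly_vs.vector_space_axioms)

section \<open>Operators that kill almost all monomials\<close>

lemma verma_norm_poly_le:
  assumes h: "h > 0" and d: "degree q \<le> M"
  shows "verma_norm h (fps_of_poly q) \<le> (\<Sum>m\<le>M. cmod (coeff q m) * sqrt (verma_weight h m))"
proof -
  have "(\<lambda>n. (cmod (coeff q n))\<^sup>2 * verma_weight h n) sums
      (\<Sum>n\<le>M. (cmod (coeff q n))\<^sup>2 * verma_weight h n)"
    by (rule sums_finite) (use d in \<open>auto simp: coeff_eq_0\<close>)
  hence "verma_norm h (fps_of_poly q) = sqrt (\<Sum>n\<le>M. (cmod (coeff q n))\<^sup>2 * verma_weight h n)"
    by (simp add: verma_norm_def sums_iff)
  also have "\<dots> = L2_set (\<lambda>m. cmod (coeff q m) * sqrt (verma_weight h m)) {..M}"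
    using verma_weight_pos[OF h]
    by (simp add: L2_set_def power_mult_distrib less_imp_le)
  also have "\<dots> \<le> (\<Sum>m\<le>M. cmod (coeff q m) * sqrt (verma_weight h m))"
    using verma_weight_pos[OF h] by (intro L2_set_le_sum) (simp add: less_imp_le)
  finally show ?thesis .
qed

lemma cmod_fps_nth_le_verma_norm:
  assumes h: "h > 0" and f: "f \<in> verma_hilbert h"
  shows "cmod (fps_nth f n) \<le> verma_norm h f / sqrt (verma_weight h n)"
proof -
  let ?a = "\<lambda>n. (cmod (fps_nth f n))\<^sup>2 * verma_weight h n"
  have nn: "0 \<le> ?a n" for n using verma_weight_pos[OF h, of n] by simp
  have "?a n = sum ?a {n}" by simp
  also have "\<dots> \<le> suminf ?a"
    using f nn by (intro sum_le_suminf) (auto simp: verma_hilbert_def)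
  finally have "sqrt (?a n) \<le> verma_norm h f"
    unfolding verma_norm_def by (rule real_sqrt_le_mono)
  thus ?thesis
    using verma_weight_pos[OF h, of n] by (simp add: real_sqrt_mult pos_le_divide_eq)
qed

text \<open>
  If \<open>S z\<^sup>n = 0\<close> for \<open>n \<ge> N\<close>, then \<open>S p\<close> depends only on the first \<open>N\<close> coefficients of \<open>p\<close>, and the
  same finite sum makes sense for power series. It is bounded because each coefficient is a bounded
  functional, and only finitely many vectors of the orthonormal basis are not killed.
\<close>

lemma eventually_vanishing_extension:
  assumes h: "h > 0" and lin: "poly_linear S"
    and ev: "\<forall>\<^sub>F n in sequentially. S (monom 1 n) = 0"
  shows "S \<in> FR h" "S \<in> HS h"
proof -
  obtain N where N: "\<And>n. n \<ge> N \<Longrightarrow> S (monom 1 n) = 0"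
    using ev by (auto simp: eventually_sequentially)
  define Q where "Q f = (\<Sum>n<N. smult (fps_nth f n) (S (monom 1 n)))" for f
  define A where "A f = fps_of_poly (Q f)" for f
  define M where "M = (\<Sum>n<N. degree (S (monom 1 n)))"
  have degQ: "degree (Q f) \<le> M" for f
    unfolding Q_def
  proof (rule degree_sum_le)
    fix n assume n: "n \<in> {..<N}"
    have "degree (S (monom 1 n)) \<le> M"
      unfolding M_def using n by (intro member_le_sum) auto
    thus "degree (smult (fps_nth f n) (S (monom 1 n))) \<le> M"
      by (rule order_trans[OF degree_smult_le])
  qed simp
  have ext: "extends_to S A"
    unfolding extends_to_def
  proof
    fix p
    have "S p = (\<Sum>n\<le>max N (degree p). smult (coeff p n) (S (monom 1 n)))"
      by (rule poly_linear_eq_sum[OF lin]) simp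
    also have "\<dots> = Q (fps_of_poly p)"
      unfolding Q_def by (rule sum.mono_neutral_cong_right) (auto simp: N)
    finally show "A (fps_of_poly p) = fps_of_poly (S p)" by (simp add: A_def)
  qed
  let ?c = "\<lambda>n m. cmod (coeff (S (monom 1 n)) m)"
  let ?w = "\<lambda>m. sqrt (verma_weight h m)"
  \<comment> \<open>the sum of \<open>\<bar>S\<^sub>m\<^sub>n\<bar> \<parallel>z\<^sup>m\<parallel> / \<parallel>z\<^sup>n\<parallel>\<close> over the matrix entries of \<open>S\<close> that can be nonzero\<close>
  define K where "K = (\<Sum>m\<le>M. (\<Sum>n<N. ?c n m / ?w n) * ?w m)"
  have bound: "verma_norm h (A f) \<le> K * verma_norm h f" if f: "f \<in> verma_hilbert h" for f
  proof -
    have "cmod (coeff (Q f) m) \<le> (\<Sum>n<N. ?c n m / ?w n) * verma_norm h f" for m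
    proof -
      have "cmod (coeff (Q f) m) \<le> (\<Sum>n<N. cmod (fps_nth f n) * ?c n m)"
        unfolding Q_def coeff_sum coeff_smult by (rule sum_norm_le) (simp add: norm_mult)
      also have "\<dots> \<le> (\<Sum>n<N. verma_norm h f / ?w n * ?c n m)"
        by (intro sum_mono mult_right_mono cmod_fps_nth_le_verma_norm h f) simp
      also have "\<dots> = (\<Sum>n<N. ?c n m / ?w n) * verma_norm h f"
        by (subst sum_distrib_right) (intro sum.cong, simp_all)
      finally show ?thesis .
    qed
    hence "(\<Sum>m\<le>M. cmod (coeff (Q f) m) * ?w m)
        \<le> (\<Sum>m\<le>M. (\<Sum>n<N. ?c n m / ?w n) * verma_norm h f * ?w m)"
      using verma_weight_pos[OF h] by (intro sum_mono mult_right_mono) (auto simp: less_imp_le)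
    also have "\<dots> = K * verma_norm h f"
      unfolding K_def sum_distrib_right[of _ "{..M}"] by (intro sum.cong) (simp_all add: mult_ac)
    finally show ?thesis
      using verma_norm_poly_le[OF h degQ, of f] unfolding A_def by linarith
  qed
  have bdd: "bounded_operator h A"
    unfolding bounded_operator_def
  proof (intro conjI ballI allI exI[of _ K])
    show "A f \<in> verma_hilbert h" for f by (simp add: A_def verma_hilbert_poly)
    show "A (f + g) = A f + A g" for f g
      by (simp add: A_def Q_def smult_add_left sum.distrib fps_of_poly_add)
    show "A (fps_scale c f) = fps_scale c (A f)" for c f
      by (simp add: A_def Q_def fps_eq_iff coeff_sum sum_distrib_left mult.assoc)
  qed (rule bound)
  have "A f \<in> fps_vs.span ((\<lambda>n. fps_of_poly (S (monom 1 n))) ` {..<N})" for f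
  proof -
    have "A f = (\<Sum>n<N. fps_scale (fps_nth f n) (fps_of_poly (S (monom 1 n))))"
      by (simp add: A_def Q_def fps_scale_def fps_of_poly_smult fps_of_poly_sum)
    thus ?thesis by (auto intro: fps_vs.span_sum fps_vs.span_scale fps_vs.span_base)
  qed
  hence "finite_rank h A"
    unfolding finite_rank_def using bdd by blast
  with ext show "S \<in> FR h" by (auto simp: FR_def)
  have "A (verma_onb h n) = 0" if "n \<ge> N" for n
    using that by (auto simp: A_def Q_def verma_onb_def intro!: sum.neutral)
  hence "summable (\<lambda>n. (verma_norm h (A (verma_onb h n)))\<^sup>2)"
    by (intro summable_finite[of "{..<N}"]) (auto simp: not_less verma_norm_def)
  with ext bdd show "S \<in> HS h" by (auto simp: HS_def hilbert_schmidt_def)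
qed

section \<open>Reduction to a basis of the Lie algebra\<close>

text \<open>
  The defect is bilinear in \<open>X\<close> and \<open>Y\<close>, hence a finite combination of the defects of basis
  elements; the largest of the finitely many thresholds works for all of them.
\<close>

lemma projective_rep_rep_ext:
  fixes t :: "'i \<Rightarrow> complex poly \<Rightarrow> complex poly"
  assumes lie: "lie_algebra pm_scale (bracket_ext b)"
    and lin: "\<And>i. poly_linear (t i)"
    and basis: "\<And>i j. \<forall>\<^sub>F n in sequentially.
      t i (t j (monom 1 n)) - t j (t i (monom 1 n)) - rep_ext t (b i j) (monom 1 n) = 0"
    and ideal: "\<And>S. poly_linear S \<Longrightarrow> \<forall>\<^sub>F n in sequentially. S (monom 1 n) = 0 \<Longrightarrow> S \<in> \<AA>"
  shows "projective_rep \<AA> pm_scale (bracket_ext b) (rep_ext t)"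
  unfolding projective_rep_def
proof (intro conjI allI)
  let ?e = "\<lambda>i. Poly_Mapping.single i (1 :: complex) :: 'i \<Rightarrow>\<^sub>0 complex"
  have pl: "poly_linear (rep_ext t X)" for X
    by (rule poly_linear_rep_ext[OF lin])
  show "lie_algebra pm_scale (bracket_ext b)" by (rule lie)
  show "poly_linear (rep_ext t X)" for X by (rule pl)
  show "Vector_Spaces.linear pm_scale smult (\<lambda>X. rep_ext t X p)" for p
    by (rule linear_rep_ext_left)
  fix X Y :: "'i \<Rightarrow>\<^sub>0 complex"
  interpret R: Vector_Spaces.linear pm_scale smult "\<lambda>X. rep_ext t X p" for p
    by (rule linear_rep_ext_left)
  interpret BL: Vector_Spaces.linear pm_scale pm_scale "\<lambda>X. bracket_ext b X Y" for Y
    by (rule linear_bracket_ext_left)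
  interpret BR: Vector_Spaces.linear pm_scale pm_scale "bracket_ext b X" for X
    by (rule linear_bracket_ext_right)
  define D where "D X Y p = rep_ext t X (rep_ext t Y p) - rep_ext t Y (rep_ext t X p)
      - rep_ext t (bracket_ext b X Y) p" for X Y p
  have DX: "Vector_Spaces.linear pm_scale smult (\<lambda>X. D X Y p)" for Y p
    by unfold_locales
      (simp_all add: D_def R.add R.scale BL.add BL.scale poly_linear_add[OF pl]
        poly_linear_smult[OF pl] smult_diff_right)
  have DY: "Vector_Spaces.linear pm_scale smult (\<lambda>Y. D X Y p)" for X p
    by unfold_locales
      (simp_all add: D_def R.add R.scale BR.add BR.scale poly_linear_add[OF pl]
        poly_linear_smult[OF pl] smult_diff_right)
  have "\<forall>\<^sub>F n in sequentially. \<forall>i\<in>Poly_Mapping.keys X. \<forall>j\<in>Poly_Mapping.keys Y.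
      D (?e i) (?e j) (monom 1 n) = 0"
    using basis by (intro eventually_ball_finite ballI)
      (simp_all add: D_def rep_ext_single bracket_ext_single)
  hence "\<forall>\<^sub>F n in sequentially. D X Y (monom 1 n) = 0"
  proof eventually_elim
    case (elim n)
    have "D (?e i) Y (monom 1 n) = 0" if "i \<in> Poly_Mapping.keys X" for i
      using elim that
      by (subst linear_pm_eq_lin_ext[OF DY]) (auto simp: lin_ext_def intro!: sum.neutral)
    thus ?case
      by (subst linear_pm_eq_lin_ext[OF DX]) (auto simp: lin_ext_def intro!: sum.neutral)
  qed
  moreover have "poly_linear (D X Y)"
    by (rule poly_linearI)
      (simp_all add: D_def poly_linear_add[OF pl] poly_linear_smult[OF pl] smult_diff_right)
  ultimately have "D X Y \<in> \<AA>" by (intro ideal)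
  thus "(\<lambda>p. rep_ext t X (rep_ext t Y p) - rep_ext t Y (rep_ext t X p)
      - rep_ext t (bracket_ext b X Y) p) \<in> \<AA>"
    by (simp add: D_def[abs_def])
qed

section \<open>The operators in the density basis\<close>

text \<open>
  The index is an integer, with value \<open>0\<close> on the negative half line, so that the formulas for
  \<open>L\<^sub>k\<close> and \<open>J\<^sub>k\<close> need no case distinction between \<open>n < k\<close> and \<open>n \<ge> k\<close>.
\<close>

definition density_basis :: "real \<Rightarrow> int \<Rightarrow> complex poly" where
  "density_basis h n =
     (if n < 0 then 0 else monom (1 / pochhammer (2 * of_real h) (nat n)) (nat n))"

lemma add_of_real_ne_0: "h > 0 \<Longrightarrow> of_nat n + 2 * complex_of_real h \<noteq> 0"
proof
  assume "h > 0" "of_nat n + 2 * complex_of_real h = 0"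
  hence "Re (of_nat n + 2 * complex_of_real h) = 0" by simp
  thus False using \<open>h > 0\<close> by simp
qed

lemma pochhammer_2h_ne_0: "h > 0 \<Longrightarrow> pochhammer (2 * complex_of_real h) n \<noteq> 0"
  using add_of_real_ne_0[of h] by (simp add: pochhammer_prod add.commute)

lemma monom_eq_density_basis:
  assumes "h > 0"
  shows "monom 1 n = smult (pochhammer (2 * of_real h) n) (density_basis h (int n))"
  using pochhammer_2h_ne_0[OF assms] by (simp add: density_basis_def smult_monom)

lemma density_basis_neg [simp]: "n < 0 \<Longrightarrow> density_basis h n = 0"
  by (simp add: density_basis_def)

lemma xi_fun_density_basis:
  "xi_fun f (density_basis h (int n)) = smult (f (of_nat n)) (density_basis h (int n))"
  by (rule poly_eqI) (simp add: coeff_xi_fun density_basis_def coeff_monom)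

lemma linear_xi_fun: "poly_linear (xi_fun f)"
  by (rule poly_linearI) (auto intro!: poly_eqI simp: coeff_xi_fun algebra_simps)

lemma linear_opL: "poly_linear (opL h k)"
  by (rule poly_linearI)
    (simp_all add: opL_def Let_def poly_linear_add[OF linear_xi_fun]
      poly_linear_smult[OF linear_xi_fun] higher_pderiv_add higher_pderiv_smult algebra_simps)

lemma linear_opF: "poly_linear (opF h)"
  by (rule poly_linearI)
    (simp_all add: opF_def poly_linear_add[OF linear_xi_fun]
      poly_linear_smult[OF linear_xi_fun] smult_add_right)

lemma linear_opJ: "poly_linear (opJ h k)"
proof -
  have "(opF h ^^ m) (p + q) = (opF h ^^ m) p + (opF h ^^ m) q"
    "(opF h ^^ m) (smult c p) = smult c ((opF h ^^ m) p)" for m p q c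
    by (induction m) (simp_all add: poly_linear_add[OF linear_opF] poly_linear_smult[OF linear_opF])
  thus ?thesis
    by (intro poly_linearI) (simp_all add: opJ_def higher_pderiv_add higher_pderiv_smult)
qed

text \<open>Here \<open>(1)\<^sub>n = n!\<close>, so that \<open>\<partial>\<^sub>z\<close> is the plain backward shift.\<close>

lemma higher_pderiv_density_basis_half:
  "(pderiv ^^ k) (density_basis (1/2) (int n)) = density_basis (1/2) (int n - int k)"
proof (induction k)
  case (Suc k)
  show ?case
  proof (cases "k < n")
    case True
    then obtain m where m: "n = Suc (k + m)"
      using less_iff_Suc_add[of k n] by auto
    have i: "int n - int k = int (Suc m)" "int n - int (Suc k) = int m" using m by auto
    have "1 + of_nat m \<noteq> (0 :: complex)" by (metis of_nat_Suc of_nat_neq_0)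
    with Suc show ?thesis
      unfolding i by (simp add: density_basis_def pderiv_monom nat_add_distrib flip: pochhammer_fact)
  next
    case False
    hence "density_basis (1/2) (int n - int k) = (if n = k then 1 else 0)"
      by (auto simp: density_basis_def)
    with Suc False show ?thesis by auto
  qed
qed simp

text \<open>
  Here \<open>(2)\<^sub>n = (n + 1)!\<close>, so that \<open>\<partial>\<^sub>z u\<^sub>n = n / (n + 1) u\<^bsub>n-1\<^esub>\<close>; the product telescopes.
\<close>

lemma higher_pderiv_density_basis_one:
  "(pderiv ^^ k) (density_basis 1 (int n)) =
     smult ((of_nat n + 1 - of_nat k) / (of_nat n + 1)) (density_basis 1 (int n - int k))"
proof (induction k)
  case 0
  have "(of_nat n + 1 :: complex) \<noteq> 0" by (metis of_nat_Suc of_nat_neq_0 add.commute)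
  thus ?case by simp
next
  case (Suc k)
  show ?case
  proof (cases "k < n")
    case True
    then obtain m where m: "n = Suc (k + m)"
      using less_iff_Suc_add[of k n] by auto
    have i: "int n - int k = int (Suc m)" "int n - int (Suc k) = int m" using m by auto
    have nz: "of_nat m + 2 \<noteq> (0 :: complex)" "of_nat k + (of_nat m + 2) \<noteq> (0 :: complex)"
      using add_of_real_ne_0[of 1 m] add_of_real_ne_0[of 1 "k + m"] by (simp_all add: add_ac)
    have "pderiv (density_basis 1 (int (Suc m))) =
        smult ((of_nat m + 1) / (of_nat m + 2)) (density_basis 1 (int m))"
      using nz by (simp add: density_basis_def pderiv_monom smult_monom pochhammer_Suc
          nat_add_distrib add.commute)
    hence "(pderiv ^^ Suc k) (density_basis 1 (int n)) =
        smult ((of_nat m + 2) / (of_nat k + (of_nat m + 2)) * ((of_nat m + 1) / (of_nat m + 2)))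
          (density_basis 1 (int m))"
      using Suc unfolding i by (simp add: pderiv_smult m add_ac)
    thus ?thesis
      unfolding i using nz by (simp add: m add_ac)
  next
    case False
    hence "density_basis 1 (int n - int k) = (if n = k then 1 else 0)"
      by (auto simp: density_basis_def)
    with Suc False show ?thesis by (auto simp: pderiv_smult)
  qed
qed

text \<open>
  For \<open>k < 0\<close> the denominator of \<open>L\<^sub>k\<close> is \<open>(2h)\<^bsub>n-k\<^esub> / (2h)\<^sub>n\<close> on \<open>z\<^sup>n\<close>, which is absorbed by the
  normalization of the basis for every \<open>h > 0\<close>. The restriction on \<open>h\<close> comes from \<open>k \<ge> 0\<close>.
\<close>

lemma opL_density_basis:
  assumes h: "h = 1 \<or> h = 1/2"
  shows "opL h k (density_basis h (int n)) =
    smult (of_nat n + (1 - of_int k) * of_real h) (density_basis h (int n - k))"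
proof (cases "k \<ge> 0")
  case True
  then obtain m where k: "k = int m" using nonneg_int_cases by blast
  show ?thesis
  proof (cases "m \<le> n")
    case True
    then obtain d where d: "n = m + d" using le_Suc_ex by blast
    have im: "int n - int m = int d" using d by simp
    show ?thesis
      using h
    proof
      assume h: "h = 1/2"
      show ?thesis
        unfolding h k opL_def higher_pderiv_density_basis_half im
        by (simp add: xi_fun_density_basis d add_ac add_divide_distrib diff_divide_distrib)
    next
      assume h: "h = 1"
      have nz: "(of_nat n + 1 :: complex) \<noteq> 0" by (metis of_nat_Suc of_nat_neq_0 add.commute)
      show ?thesis
        unfolding h k opL_def higher_pderiv_density_basis_one im
          poly_linear_smult[OF linear_xi_fun]
        using nz by (simp add: xi_fun_density_basis d add_ac)
    qed
  next
    case False
    hence 0: "density_basis h (int n - int m) = 0" by simp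
    have "(pderiv ^^ m) (density_basis h (int n)) = 0"
      by (metis h 0 higher_pderiv_density_basis_half higher_pderiv_density_basis_one smult_0_right)
    with 0 show ?thesis by (simp add: opL_def k poly_linear_0[OF linear_xi_fun])
  qed
next
  case False
  define m where "m = nat (- k)"
  have k: "k = - int m" and m: "m > 0" using False by (auto simp: m_def)
  have h0: "h > 0" using h by auto
  define P where "P = (\<Prod>i<m. of_nat n + 2 * complex_of_real h + of_nat i)"
  have poch: "pochhammer (2 * complex_of_real h) (n + m) = pochhammer (2 * complex_of_real h) n * P"
    unfolding pochhammer_product' by (simp add: P_def pochhammer_prod atLeast0LessThan add_ac)
  have nz: "P \<noteq> 0" using pochhammer_2h_ne_0[OF h0, of "n + m"] poch by auto
  have "opL h k (density_basis h (int n)) =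
     monom 1 m * smult ((of_nat n + (1 + of_nat m) * of_real h) / P) (density_basis h (int n))"
    unfolding opL_def xi_fun_density_basis Let_def using m by (simp add: k P_def add.commute)
  also have "\<dots> = smult (of_nat n + (1 - of_int k) * of_real h) (density_basis h (int n - k))"
    using nz by (simp add: density_basis_def k smult_monom mult_monom poch nat_add_distrib
        add.commute[of m n])
  finally show ?thesis .
qed

lemma opF_density_basis:
  assumes h: "h > 0"
  shows "opF h (density_basis h (int n)) = density_basis h (int n + 1)"
  unfolding opF_def xi_fun_density_basis using add_of_real_ne_0[OF h, of n]
  by (simp add: density_basis_def smult_monom nat_add_distrib pochhammer_Suc monom_altdef
      mult_ac add.commute)

lemma opJ_density_basis:
  "opJ (1/2) k (density_basis (1/2) (int n)) = density_basis (1/2) (int n - k)"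
proof (cases "k \<ge> 0")
  case True
  thus ?thesis by (simp add: opJ_def higher_pderiv_density_basis_half)
next
  case False
  have "(opF (1/2) ^^ m) (density_basis (1/2) (int n)) = density_basis (1/2) (int (n + m))" for m
    by (induction m) (simp_all add: opF_density_basis del: of_nat_add, simp add: add_ac)
  with False show ?thesis by (simp add: opJ_def)
qed

section \<open>The defects of basis elements\<close>

lemma eventually_monom_if_density_basis:
  assumes h: "h > 0" and S: "poly_linear S"
    and ev: "\<And>n. int n \<ge> N \<Longrightarrow> S (density_basis h (int n)) = 0"
  shows "\<forall>\<^sub>F n in sequentially. S (monom 1 n) = 0"
  using eventually_ge_at_top[of "nat N"]
  by eventually_elim
    (simp add: monom_eq_density_basis[OF h] poly_linear_smult[OF S] ev)

text \<open>
  The bound \<open>n \<ge> \<bar>k\<bar>\<close> keeps \<open>n - k\<close> on the half line, where the formulas for the second operator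
  are valid.
\<close>

lemma opL_opL_density_basis:
  assumes h: "h = 1 \<or> h = 1/2" and n: "int n \<ge> \<bar>k\<bar>"
  shows "opL h j (opL h k (density_basis h (int n))) =
    smult ((of_nat n + (1 - of_int k) * of_real h)
      * (of_nat n - of_int k + (1 - of_int j) * of_real h)) (density_basis h (int n - (j + k)))"
proof -
  obtain m where m: "int n - k = int m" using n by (intro that[of "nat (int n - k)"]) simp
  hence i: "int n - (j + k) = int m - j" by simp
  have "of_nat m = of_nat n - (of_int k :: complex)"
    by (metis m of_int_diff of_int_of_nat_eq)
  thus ?thesis
    by (simp add: opL_density_basis[OF h] m poly_linear_smult[OF linear_opL] i)
qed

lemma opL_opJ_density_basis:
  assumes n: "int n \<ge> \<bar>k\<bar>"
  shows "opL (1/2) j (opJ (1/2) k (density_basis (1/2) (int n))) =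
    smult (of_nat n - of_int k + (1 - of_int j) / 2) (density_basis (1/2) (int n - (j + k)))"
proof -
  obtain m where m: "int n - k = int m" using n by (intro that[of "nat (int n - k)"]) simp
  hence i: "int n - (j + k) = int m - j" by simp
  have "of_nat m = of_nat n - (of_int k :: complex)"
    by (metis m of_int_diff of_int_of_nat_eq)
  thus ?thesis
    by (simp add: opJ_density_basis opL_density_basis m i)
qed

lemma opJ_opL_density_basis:
  assumes n: "int n \<ge> \<bar>k\<bar>"
  shows "opJ (1/2) j (opL (1/2) k (density_basis (1/2) (int n))) =
    smult (of_nat n + (1 - of_int k) / 2) (density_basis (1/2) (int n - (j + k)))"
proof -
  obtain m where m: "int n - k = int m" using n by (intro that[of "nat (int n - k)"]) simp
  hence i: "int n - (j + k) = int m - j" by simp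
  show ?thesis
    by (simp add: opJ_density_basis opL_density_basis m i poly_linear_smult[OF linear_opJ])
qed

lemma opJ_opJ_density_basis:
  assumes n: "int n \<ge> \<bar>k\<bar>"
  shows "opJ (1/2) j (opJ (1/2) k (density_basis (1/2) (int n))) =
    density_basis (1/2) (int n - (j + k))"
proof -
  obtain m where m: "int n - k = int m" using n by (intro that[of "nat (int n - k)"]) simp
  hence i: "int n - (j + k) = int m - j" by simp
  show ?thesis by (simp add: opJ_density_basis m i)
qed

lemma rep_ext_of_single: "rep_ext t (Poly_Mapping.single i c) p = smult c (t i p)"
  by (simp add: rep_ext_def lin_ext_def)

lemma rep_ext_zero: "rep_ext t 0 p = 0"
  by (simp add: rep_ext_def lin_ext_def)

lemma opL_defect:
  assumes h: "h = 1 \<or> h = 1/2" and n: "int n \<ge> \<bar>j\<bar> + \<bar>k\<bar>"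
  shows "opL h j (opL h k (density_basis h (int n))) - opL h k (opL h j (density_basis h (int n)))
    - smult (of_int (j - k)) (opL h (j + k) (density_basis h (int n))) = 0"
proof -
  have jk: "int n \<ge> \<bar>j\<bar>" "int n \<ge> \<bar>k\<bar>" using n by auto
  show ?thesis
    unfolding opL_opL_density_basis[OF h jk(1)] opL_opL_density_basis[OF h jk(2)]
    unfolding opL_density_basis[OF h] add.commute[of k j] smult_smult smult_diff_left[symmetric]
    by (simp add: algebra_simps)
qed

lemma opL_opJ_defect:
  assumes n: "int n \<ge> \<bar>j\<bar> + \<bar>k\<bar>"
  shows "opL (1/2) j (opJ (1/2) k (density_basis (1/2) (int n)))
    - opJ (1/2) k (opL (1/2) j (density_basis (1/2) (int n)))
    + smult (of_int k) (opJ (1/2) (j + k) (density_basis (1/2) (int n))) = 0"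
proof -
  have jk: "int n \<ge> \<bar>j\<bar>" "int n \<ge> \<bar>k\<bar>" using n by auto
  show ?thesis
    unfolding opL_opJ_density_basis[OF jk(2)] opJ_opL_density_basis[OF jk(1)]
    unfolding opJ_density_basis add.commute[of k j] smult_diff_left[symmetric]
      smult_add_left[symmetric]
    by simp
qed

lemma opJ_defect:
  assumes n: "int n \<ge> \<bar>j\<bar> + \<bar>k\<bar>"
  shows "opJ (1/2) j (opJ (1/2) k (density_basis (1/2) (int n))) =
    opJ (1/2) k (opJ (1/2) j (density_basis (1/2) (int n)))"
proof -
  have jk: "int n \<ge> \<bar>j\<bar>" "int n \<ge> \<bar>k\<bar>" using n by auto
  show ?thesis
    unfolding opJ_opJ_density_basis[OF jk(1)] opJ_opJ_density_basis[OF jk(2)]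
      add.commute[of k j] ..
qed

lemma linear_basis_defect:
  assumes "\<And>i. poly_linear (t i)"
  shows "poly_linear (\<lambda>p. t i (t j p) - t j (t i p) - rep_ext t X p)"
  by (rule poly_linearI)
    (simp_all add: poly_linear_add[OF assms] poly_linear_smult[OF assms] smult_diff_right
      poly_linear_add[OF poly_linear_rep_ext[OF assms]]
      poly_linear_smult[OF poly_linear_rep_ext[OF assms]])

lemma witt_rep_projective:
  assumes h: "h = 1 \<or> h = 1/2"
    and ideal: "\<And>S. poly_linear S \<Longrightarrow> \<forall>\<^sub>F n in sequentially. S (monom 1 n) = 0 \<Longrightarrow> S \<in> \<AA>"
  shows "projective_rep \<AA> pm_scale witt_bracket (witt_rep h)"
  unfolding witt_bracket_def witt_rep_def
proof (rule projective_rep_rep_ext[OF lie_algebra_witt[unfolded witt_bracket_def]])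
  fix j k
  have h0: "h > 0" using h by auto
  show "\<forall>\<^sub>F n in sequentially. opL h j (opL h k (monom 1 n)) - opL h k (opL h j (monom 1 n))
      - rep_ext (opL h) (witt_b j k) (monom 1 n) = 0"
    by (rule eventually_monom_if_density_basis[OF h0 linear_basis_defect, of _ "\<bar>j\<bar> + \<bar>k\<bar>"])
      (use opL_defect[OF h] in \<open>simp_all add: linear_opL witt_b_def rep_ext_of_single\<close>)
qed (use ideal linear_opL in auto)

text \<open>
  The central term of the bracket of \<open>a\<^sub>n\<close> and \<open>a\<^bsub>-n\<^esub>\<close> is invisible, as the centre acts by \<open>0\<close> and
  the compressed shifts commute away from the boundary.
\<close>

lemma wh_rep_projective:
  assumes ideal: "\<And>S. poly_linear S \<Longrightarrow> \<forall>\<^sub>F n in sequentially. S (monom 1 n) = 0 \<Longrightarrow> S \<in> \<AA>"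
  shows "projective_rep \<AA> pm_scale wh_bracket (wh_rep (1/2))"
  unfolding wh_bracket_def wh_rep_def
proof (rule projective_rep_rep_ext[OF lie_algebra_wh[unfolded wh_bracket_def]])
  let ?t = "\<lambda>x. case x of E k \<Rightarrow> opL (1/2) k | Heis k \<Rightarrow> opJ (1/2) k | Cent \<Rightarrow> (\<lambda>p. 0)"
  show lin: "poly_linear (?t x)" for x
    by (cases x) (auto simp: linear_opL linear_opJ intro!: poly_linearI)
  define deg where "deg x = (case x of E k \<Rightarrow> \<bar>k\<bar> | Heis k \<Rightarrow> \<bar>k\<bar> | Cent \<Rightarrow> 0)" for x
  fix x y
  have zero: "opL (1/2) k 0 = 0" "opJ (1/2) k 0 = 0" for k
    by (rule poly_linear_0[OF linear_opL], rule poly_linear_0[OF linear_opJ])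
  have "?t x (?t y (density_basis (1/2) (int n))) - ?t y (?t x (density_basis (1/2) (int n)))
      - rep_ext ?t (wh_b x y) (density_basis (1/2) (int n)) = 0"
    if n: "int n \<ge> deg x + deg y" for n
  proof (cases x; cases y)
    fix j k assume "x = E j" "y = E k"
    with n show ?thesis
      using opL_defect[of "1/2" j k n] by (simp add: rep_ext_of_single deg_def)
  next
    fix j k assume "x = E j" "y = Heis k"
    with n show ?thesis
      using opL_opJ_defect[of j k n] by (simp add: rep_ext_of_single deg_def)
  next
    fix j k assume xy: "x = Heis k" "y = E j"
    have "int n \<ge> \<bar>j\<bar> + \<bar>k\<bar>" using n xy by (simp add: deg_def)
    from opL_opJ_defect[OF this] xy show ?thesis
      by (simp add: rep_ext_of_single algebra_simps add_eq_0_iff2)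
  next
    fix j k assume "x = Heis j" "y = Heis k"
    with n show ?thesis
      using opJ_defect[of j k n] by (simp add: rep_ext_of_single rep_ext_zero deg_def)
  qed (simp_all add: rep_ext_zero zero)
  thus "\<forall>\<^sub>F n in sequentially. ?t x (?t y (monom 1 n)) - ?t y (?t x (monom 1 n))
      - rep_ext ?t (wh_b x y) (monom 1 n) = 0"
    by (intro eventually_monom_if_density_basis[of "1/2", OF _ linear_basis_defect[OF lin]]) simp_all
qed (rule ideal)

theorem mainTheorem2:
  shows "(\<forall>h\<in>{1, 1/2}.
            projective_rep (HS h) pm_scale witt_bracket (witt_rep h) \<and>
            projective_rep (FR h) pm_scale witt_bracket (witt_rep h)) \<and>
         projective_rep (HS (1/2)) pm_scale wh_bracket (wh_rep (1/2)) \<and>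
         projective_rep (FR (1/2)) pm_scale wh_bracket (wh_rep (1/2))"
proof (intro conjI ballI)
  fix h :: real assume "h \<in> {1, 1/2}"
  hence h: "h = 1 \<or> h = 1/2" and h0: "h > 0" by auto
  show "projective_rep (HS h) pm_scale witt_bracket (witt_rep h)"
    by (intro witt_rep_projective h eventually_vanishing_extension h0)
  show "projective_rep (FR h) pm_scale witt_bracket (witt_rep h)"
    by (intro witt_rep_projective h eventually_vanishing_extension h0)
next
  show "projective_rep (HS (1/2)) pm_scale wh_bracket (wh_rep (1/2))"
    by (intro wh_rep_projective eventually_vanishing_extension) simp_all
  show "projective_rep (FR (1/2)) pm_scale wh_bracket (wh_rep (1/2))"
    by (intro wh_rep_projective eventually_vanishing_extension) simp_all
qed

end
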